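(* Let $R$ be a commutative ring with unity. Let $C$ be a cycle on $n$ vertices $v_1,\dots,v_n$. For each $1\le i\le n$ let $T_i$ be a tree, possibly consisting of a single vertex. Let $G_1$ be the graph formed by pasting $T_1$ to $C$ at $v_1$, and for each $2\le i\le n$ let $G_i$ be the graph formed by pasting $T_i$ to $G_{i-1}$ at $v_i$ (so $V(T_i)\cap V(G_{i-1})=\{v_i\}$). Let $\alpha$ be an edge-labeling of $G_n$ over $R$, with each $G_j$ carrying the restricted labeling. Then $(G_n,\alpha)$ satisfies the Universal Difference Property if and only if both of the following hold: (i) $G_j$ (with the restricted labeling) satisfies the Universal Difference Property for all $1\le j\le n-1$; (ii) for every $u\in V(G_{n-1})$ and $w\in V(T_n)$, $$\bigcap_{P\in\mathcal{P}(u,w)}\alpha(P)=\Big(\bigcap_{P\in\mathcal{P}(u,v_n)}\alpha(P)\Big)+\Big(\bigcap_{P\in\mathcal{P}(v_n,w)}\alpha(P)\Big),$$ where $\mathcal{P}(a,b)$ denotes the set of paths from $a$ to $b$ in $G_n$.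
   Context: An edge-labeling of a graph over $R$ assigns to each edge an ideal of $R$. A spline on $(G,\alpha)$ is a function $\rho:V(G)\to R$ with $\rho(u)-\rho(v)\in\alpha(uv)$ for every edge $uv$. A path has no repeated vertices; $\alpha(P)$ is the sum of the ideals labeling the edges of the path $P$. Pasting two graphs at a vertex $z$ means taking their union where they share only the vertex $z$. An edge-labeled graph $(G,\alpha)$ satisfies the Universal Difference Property (UDP) if for every pair of vertices $u,w$ and every $x\in\bigcap_{P}\alpha(P)$ (intersection over all paths $P$ in $G$ from $u$ to $w$) there is a spline $\rho$ on $(G,\alpha)$ with $\rho(u)-\rho(w)=x$. *)

theory Defs
  imports "HOL-Algebra.Ideal"
begin

record 'v ugraph =
  verts :: "'v set"
  edges :: "'v set set"

definition simple_graph :: "'v ugraph \<Rightarrow> bool" where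
  "simple_graph G \<longleftrightarrow>
     (\<forall>e\<in>edges G. \<exists>u v. u \<in> verts G \<and> v \<in> verts G \<and> u \<noteq> v \<and> e = {u, v})"

definition subgraph :: "'v ugraph \<Rightarrow> 'v ugraph \<Rightarrow> bool" where
  "subgraph H G \<longleftrightarrow> verts H \<subseteq> verts G \<and> edges H \<subseteq> edges G"

text \<open>A path is the list of its vertices; a one-element list is the trivial path
  from a vertex to itself.\<close>

definition paths :: "'v ugraph \<Rightarrow> 'v \<Rightarrow> 'v \<Rightarrow> 'v list set" where
  "paths G u w =
     {p. p \<noteq> [] \<and> hd p = u \<and> last p = w \<and> distinct p \<and> set p \<subseteq> verts G \<and>
         (\<forall>i. Suc i < length p \<longrightarrow> {p ! i, p ! Suc i} \<in> edges G)}"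

definition connected_graph :: "'v ugraph \<Rightarrow> bool" where
  "connected_graph G \<longleftrightarrow>
     verts G \<noteq> {} \<and> (\<forall>u\<in>verts G. \<forall>w\<in>verts G. paths G u w \<noteq> {})"

definition cycle_graph :: "'v ugraph \<Rightarrow> bool" where
  "cycle_graph C \<longleftrightarrow>
     (\<exists>c. distinct c \<and> length c \<ge> 3 \<and> verts C = set c \<and>
          edges C = {{c ! i, c ! (Suc i mod length c)} | i. i < length c})"

definition tree :: "'v ugraph \<Rightarrow> bool" where
  "tree T \<longleftrightarrow> simple_graph T \<and> connected_graph T \<and> \<not> (\<exists>C. cycle_graph C \<and> subgraph C T)"

definition pasting :: "'v ugraph \<Rightarrow> 'v ugraph \<Rightarrow> 'v \<Rightarrow> 'v ugraph \<Rightarrow> bool" where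
  "pasting H T z G \<longleftrightarrow>
     verts H \<inter> verts T = {z} \<and>
     G = \<lparr>verts = verts H \<union> verts T, edges = edges H \<union> edges T\<rparr>"

text \<open>Labelings are total functions of which only the values on the edges of the graph
  matter, so the restriction of a labeling to a subgraph is the same function.\<close>

definition edge_labeling ::
    "('a, 'm) ring_scheme \<Rightarrow> 'v ugraph \<Rightarrow> ('v set \<Rightarrow> 'a set) \<Rightarrow> bool" where
  "edge_labeling R G \<alpha> \<longleftrightarrow> (\<forall>e\<in>edges G. ideal (\<alpha> e) R)"

definition spline ::
    "('a, 'm) ring_scheme \<Rightarrow> 'v ugraph \<Rightarrow> ('v set \<Rightarrow> 'a set) \<Rightarrow> ('v \<Rightarrow> 'a) \<Rightarrow> bool" where
  "spline R G \<alpha> \<rho> \<longleftrightarrow>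
     \<rho> \<in> verts G \<rightarrow> carrier R \<and>
     (\<forall>u v. {u, v} \<in> edges G \<longrightarrow> \<rho> u \<ominus>\<^bsub>R\<^esub> \<rho> v \<in> \<alpha> {u, v})"

fun path_label ::
    "('a, 'm) ring_scheme \<Rightarrow> ('v set \<Rightarrow> 'a set) \<Rightarrow> 'v list \<Rightarrow> 'a set" where
  "path_label R \<alpha> (u # v # p) = \<alpha> {u, v} <+>\<^bsub>R\<^esub> path_label R \<alpha> (v # p)"
| "path_label R \<alpha> _ = {\<zero>\<^bsub>R\<^esub>}"

text \<open>The intersection is taken inside \<open>carrier R\<close>, so that it is the whole ring if there is
  no path between the two vertices.\<close>

definition path_inter ::
    "('a, 'm) ring_scheme \<Rightarrow> 'v ugraph \<Rightarrow> ('v set \<Rightarrow> 'a set) \<Rightarrow> 'v \<Rightarrow> 'v \<Rightarrow> 'a set" where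
  "path_inter R G \<alpha> u w = carrier R \<inter> (\<Inter>p\<in>paths G u w. path_label R \<alpha> p)"

definition UDP ::
    "('a, 'm) ring_scheme \<Rightarrow> 'v ugraph \<Rightarrow> ('v set \<Rightarrow> 'a set) \<Rightarrow> bool" where
  "UDP R G \<alpha> \<longleftrightarrow>
     (\<forall>u\<in>verts G. \<forall>w\<in>verts G. \<forall>x\<in>path_inter R G \<alpha> u w.
        \<exists>\<rho>. spline R G \<alpha> \<rho> \<and> \<rho> u \<ominus>\<^bsub>R\<^esub> \<rho> w = x)"

end

theory Submission imports Defs begin

text \<open>
  A graph has the Universal Difference Property iff, for any two vertices, the intersection of the
  path ideals equals the set of differences \<open>\<rho> u - \<rho> w\<close> of splines \<open>\<rho>\<close>. When \<open>G\<close> is obtained by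
  pasting \<open>T\<close> to \<open>H\<close> at \<open>z\<close>, both sides for two vertices of the same part are computed in that
  part, and for \<open>u\<close> in \<open>H\<close> and \<open>w\<close> in \<open>T\<close> the set of differences of \<open>G\<close> is the sum of that of \<open>H\<close>
  for \<open>u, z\<close> and that of \<open>T\<close> for \<open>z, w\<close>, because splines on the parts can be translated to agree at
  \<open>z\<close>. Hence \<open>G\<close> has the property iff both parts have it and the intersections of path ideals
  decompose at \<open>z\<close>. Trees always have the property: across the first edge \<open>uv\<close> of a path, a spline
  can be replaced by any constant \<open>\<rho> v + a\<close> with \<open>a \<in> \<alpha>(uv)\<close> on the branch of the tree behind \<open>u\<close>.
\<close>

section \<open>Graphs and paths\<close>

abbreviation adjacent :: "'v ugraph \<Rightarrow> 'v \<Rightarrow> 'v \<Rightarrow> bool" where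
  "adjacent G \<equiv> \<lambda>x y. {x, y} \<in> edges G"

definition wf_graph :: "'v ugraph \<Rightarrow> bool" where
  "wf_graph G \<longleftrightarrow> \<Union>(edges G) \<subseteq> verts G"

lemma wf_graph_adjacentD:
  assumes "wf_graph G" "adjacent G x y"
  shows "x \<in> verts G" "y \<in> verts G"
  using assms by (auto simp: wf_graph_def)

lemma simple_graph_imp_wf_graph: "simple_graph G \<Longrightarrow> wf_graph G"
  by (fastforce simp: simple_graph_def wf_graph_def)

lemma cycle_graph_imp_wf_graph:
  assumes "cycle_graph C"
  shows "wf_graph C"
proof -
  obtain c where c: "length c \<ge> 3" "verts C = set c"
    "edges C = {{c ! i, c ! (Suc i mod length c)} | i. i < length c}"
    using assms unfolding cycle_graph_def by blast
  have "Suc i mod length c < length c" for i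
    using c(1) by (intro mod_less_divisor) auto
  thus ?thesis
    by (auto simp: wf_graph_def c(2,3))
qed

lemma card_verts_cycle_graph: "cycle_graph C \<Longrightarrow> card (verts C) \<ge> 3"
  by (auto simp: cycle_graph_def distinct_card)

lemma in_paths_iff:
  "p \<in> paths G u w \<longleftrightarrow>
     p \<noteq> [] \<and> hd p = u \<and> last p = w \<and> distinct p \<and> set p \<subseteq> verts G \<and> successively (adjacent G) p"
  by (simp add: paths_def successively_conv_nth)

lemma rev_in_paths: "p \<in> paths G u w \<Longrightarrow> rev p \<in> paths G w u"
  by (auto simp: in_paths_iff hd_rev last_rev insert_commute)

lemma path_endpoints:
  assumes "p \<in> paths G u w"
  shows "u \<in> verts G" "w \<in> verts G"
  using assms by (auto simp: in_paths_iff)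

lemma path_extend_edge:
  assumes "p \<in> paths G u x" "adjacent G x y" "y \<in> verts G"
  obtains q where "q \<in> paths G u y" "set q \<subseteq> insert y (set p)"
proof (cases "y \<in> set p")
  case True
  then obtain p1 p2 where p: "p = p1 @ y # p2"
    by (meson split_list)
  have "p1 @ [y] \<in> paths G u y"
    using assms(1) by (auto simp: p in_paths_iff successively_append_iff hd_append split: if_splits)
  with that[of "p1 @ [y]"] show ?thesis
    by (auto simp: p)
next
  case False
  hence "p @ [y] \<in> paths G u y"
    using assms by (auto simp: in_paths_iff successively_append_iff)
  thus ?thesis
    using that by auto
qed

lemma closed_path_contains_cycle:
  assumes "p \<in> paths G u w" "length p \<ge> 3" "adjacent G w u"
  obtains C where "cycle_graph C" "subgraph C G"
proof
  define C where "C = \<lparr>verts = set p, edges = {{p ! i, p ! (Suc i mod length p)} | i. i < length p}\<rparr>"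
  show "cycle_graph C"
    unfolding cycle_graph_def using assms(1,2)
    by (intro exI[of _ p]) (simp add: C_def in_paths_iff)
  have "{p ! i, p ! (Suc i mod length p)} \<in> edges G" if "i < length p" for i
  proof (cases "Suc i < length p")
    case True
    thus ?thesis
      using assms(1) by (simp add: paths_def)
  next
    case False
    hence last: "Suc i = length p" "i = length p - 1"
      using that by simp_all
    have "p ! (length p - 1) = w" "p ! 0 = u"
      using assms(1) by (auto simp: in_paths_iff last_conv_nth hd_conv_nth)
    thus ?thesis
      using last assms(3) by simp
  qed
  thus "subgraph C G"
    using assms(1) by (auto simp: subgraph_def C_def in_paths_iff)
qed

section \<open>Forests\<close>

definition forest :: "'v ugraph \<Rightarrow> bool" where
  "forest F \<longleftrightarrow> simple_graph F \<and> \<not> (\<exists>C. cycle_graph C \<and> subgraph C F)"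

lemma tree_imp_forest: "tree T \<Longrightarrow> forest T"
  by (simp add: tree_def forest_def)

lemma forest_imp_wf_graph: "forest F \<Longrightarrow> wf_graph F"
  by (simp add: forest_def simple_graph_imp_wf_graph)

definition branch :: "'v ugraph \<Rightarrow> 'v \<Rightarrow> 'v \<Rightarrow> 'v set" where
  "branch G u v = {y. \<exists>p\<in>paths G u y. v \<notin> set p}"

lemma forest_branch_boundary:
  assumes "forest F" "adjacent F u v" "adjacent F x y" "x \<in> branch F u v" "y \<notin> branch F u v"
  shows "x = u" "y = v"
proof -
  have y: "y \<in> verts F"
    using wf_graph_adjacentD(2)[OF forest_imp_wf_graph[OF assms(1)] assms(3)] .
  obtain p where p: "p \<in> paths F u x" "v \<notin> set p"
    using assms(4) by (auto simp: branch_def)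
  obtain q where "q \<in> paths F u y" "set q \<subseteq> insert y (set p)"
    using path_extend_edge[OF p(1) assms(3) y] .
  thus "y = v"
    using p(2) assms(5) by (auto simp: branch_def)
  show "x = u"
  proof (rule ccontr)
    assume "x \<noteq> u"
    hence "length (p @ [v]) \<ge> 3"
      using p(1) by (cases p rule: remdups_adj.cases) (auto simp: in_paths_iff)
    moreover have "p @ [v] \<in> paths F u v"
      using p y assms(3) \<open>y = v\<close> by (auto simp: in_paths_iff successively_append_iff)
    moreover have "adjacent F v u"
      using assms(2) by (simp add: insert_commute)
    ultimately show False
      using assms(1) closed_path_contains_cycle unfolding forest_def by metis
  qed
qed

lemma forest_path_leaves_branch:
  assumes "forest F" "u # v # p \<in> paths F u w"
  shows "w \<notin> branch F u v"
proof -
  have edge: "adjacent F u v" and walk: "successively (adjacent F) (v # p)" "u \<notin> set (v # p)"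
    and w: "w = last (v # p)"
    using assms(2) by (auto simp: in_paths_iff)
  have stays_outside: "last q \<notin> branch F u v"
    if "q \<noteq> []" "hd q \<notin> branch F u v" "u \<notin> set q" "successively (adjacent F) q" for q
    using that
  proof (induction q rule: induct_list012)
    case (3 x y q)
    have "y \<notin> branch F u v"
      using forest_branch_boundary(1)[OF assms(1) edge, of y x] "3.prems" by (auto simp: insert_commute)
    thus ?case
      using 3 by auto
  qed auto
  have "v \<notin> branch F u v"
    by (auto simp: branch_def in_paths_iff)
  thus ?thesis
    unfolding w using walk by (intro stays_outside) auto
qed

section \<open>Labels of paths and differences of splines\<close>

definition spline_diffs ::
    "('a, 'm) ring_scheme \<Rightarrow> 'v ugraph \<Rightarrow> ('v set \<Rightarrow> 'a set) \<Rightarrow> 'v \<Rightarrow> 'v \<Rightarrow> 'a set" where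
  "spline_diffs R G \<alpha> u w = {\<rho> u \<ominus>\<^bsub>R\<^esub> \<rho> w | \<rho>. spline R G \<alpha> \<rho>}"

lemma spline_diffsI:
  "spline R G \<alpha> \<rho> \<Longrightarrow> x = \<rho> u \<ominus>\<^bsub>R\<^esub> \<rho> w \<Longrightarrow> x \<in> spline_diffs R G \<alpha> u w"
  by (auto simp: spline_diffs_def)

lemma spline_diffsE:
  assumes "x \<in> spline_diffs R G \<alpha> u w"
  obtains \<rho> where "spline R G \<alpha> \<rho>" "x = \<rho> u \<ominus>\<^bsub>R\<^esub> \<rho> w"
  using assms by (auto simp: spline_diffs_def)

lemma UDP_iff_path_inter_subset:
  "UDP R G \<alpha> \<longleftrightarrow>
     (\<forall>u\<in>verts G. \<forall>w\<in>verts G. path_inter R G \<alpha> u w \<subseteq> spline_diffs R G \<alpha> u w)"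
  by (fastforce simp: UDP_def intro: spline_diffsI elim: spline_diffsE)

lemma spline_closed: "spline R G \<alpha> \<rho> \<Longrightarrow> x \<in> verts G \<Longrightarrow> \<rho> x \<in> carrier R"
  by (auto simp: spline_def)

lemma spline_adjacentD: "spline R G \<alpha> \<rho> \<Longrightarrow> adjacent G x y \<Longrightarrow> \<rho> x \<ominus>\<^bsub>R\<^esub> \<rho> y \<in> \<alpha> {x, y}"
  by (simp add: spline_def)

lemma spline_subgraph: "spline R G \<alpha> \<rho> \<Longrightarrow> subgraph H G \<Longrightarrow> spline R H \<alpha> \<rho>"
  by (auto simp: spline_def subgraph_def)

context ring
begin

lemma zero_set_add: "A \<subseteq> carrier R \<Longrightarrow> {\<zero>} <+>\<^bsub>R\<^esub> A = A"
  by (force simp: set_add_def')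

lemma set_add_zero: "A \<subseteq> carrier R \<Longrightarrow> A <+>\<^bsub>R\<^esub> {\<zero>} = A"
  by (force simp: set_add_def')

lemma set_add_assoc:
  assumes "A \<subseteq> carrier R" "B \<subseteq> carrier R" "D \<subseteq> carrier R"
  shows "(A <+>\<^bsub>R\<^esub> B) <+>\<^bsub>R\<^esub> D = A <+>\<^bsub>R\<^esub> (B <+>\<^bsub>R\<^esub> D)"
  using assms add.set_mult_assoc by (simp add: set_add_defs(1))

lemma minus_add_minus:
  assumes "a \<in> carrier R" "b \<in> carrier R" "c \<in> carrier R"
  shows "(a \<ominus> b) \<oplus> (b \<ominus> c) = a \<ominus> c"
  using assms by algebra

end

locale labeled_graph = ring R for R (structure) +
  fixes G :: "'v ugraph" and \<alpha> :: "'v set \<Rightarrow> 'a set"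
  assumes wf_graph: "wf_graph G" and edge_labeling: "edge_labeling R G \<alpha>"
begin

lemma ideal_label: "adjacent G x y \<Longrightarrow> ideal (\<alpha> {x, y}) R"
  using edge_labeling by (auto simp: edge_labeling_def)

lemma label_closed: "adjacent G x y \<Longrightarrow> \<alpha> {x, y} \<subseteq> carrier R"
  using ideal.Icarr[OF ideal_label] by blast

lemma path_label_closed:
  "successively (adjacent G) p \<Longrightarrow> path_label R \<alpha> p \<subseteq> carrier R"
  by (induction p rule: induct_list012) (auto simp: label_closed set_add_closed)

lemma path_label_append:
  assumes "successively (adjacent G) (p @ z # q)"
  shows "path_label R \<alpha> (p @ z # q) = path_label R \<alpha> (p @ [z]) <+>\<^bsub>R\<^esub> path_label R \<alpha> (z # q)"
  using assms
proof (induction p rule: induct_list012)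
  case 1
  thus ?case
    using path_label_closed by (simp add: zero_set_add)
next
  case (2 x)
  thus ?case
    using label_closed by (simp add: set_add_zero)
next
  case (3 x y p)
  have "successively (adjacent G) ((y # p) @ [z])" "successively (adjacent G) (z # q)"
    using "3.prems" by (auto simp: successively_append_iff simp flip: append_Cons)
  hence "path_label R \<alpha> (y # p @ [z]) \<subseteq> carrier R" "path_label R \<alpha> (z # q) \<subseteq> carrier R"
    using path_label_closed by auto
  thus ?case
    using "3.IH"(2) "3.prems" label_closed by (simp add: set_add_assoc)
qed

lemma path_label_rev:
  "successively (adjacent G) p \<Longrightarrow> path_label R \<alpha> (rev p) = path_label R \<alpha> p"
proof (induction p rule: induct_list012)
  case (3 x y p)
  have walk: "successively (adjacent G) (y # p)" "adjacent G x y"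
    using "3.prems" by auto
  have "successively (adjacent G) (rev (x # y # p))"
    using "3.prems" unfolding successively_rev by (simp add: insert_commute)
  hence "path_label R \<alpha> (rev (x # y # p)) = path_label R \<alpha> (rev (y # p)) <+>\<^bsub>R\<^esub> path_label R \<alpha> [y, x]"
    using path_label_append[of "rev p" y "[x]"] by simp
  also have "\<dots> = path_label R \<alpha> (y # p) <+>\<^bsub>R\<^esub> \<alpha> {x, y}"
    using "3.IH"(2)[OF walk(1)] label_closed[OF walk(2)] by (simp add: set_add_zero insert_commute)
  also have "\<dots> = path_label R \<alpha> (x # y # p)"
    using set_add_comm path_label_closed[OF walk(1)] label_closed[OF walk(2)] by simp
  finally show ?case .
qed auto

lemma path_inter_commute: "path_inter R G \<alpha> u w = path_inter R G \<alpha> w u"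
proof -
  have "path_inter R G \<alpha> u w \<subseteq> path_inter R G \<alpha> w u" for u w
  proof
    fix x assume x: "x \<in> path_inter R G \<alpha> u w"
    have "x \<in> path_label R \<alpha> p" if "p \<in> paths G w u" for p
    proof -
      have "x \<in> path_label R \<alpha> (rev p)"
        using x rev_in_paths[OF that] by (auto simp: path_inter_def)
      thus ?thesis
        using that by (simp add: path_label_rev in_paths_iff)
    qed
    thus "x \<in> path_inter R G \<alpha> w u"
      using x by (auto simp: path_inter_def)
  qed
  thus ?thesis by blast
qed

lemma spline_diff_in_path_label:
  assumes "spline R G \<alpha> \<rho>" "p \<noteq> []" "set p \<subseteq> verts G" "successively (adjacent G) p"
  shows "\<rho> (hd p) \<ominus> \<rho> (last p) \<in> path_label R \<alpha> p"
  using assms(2-)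
proof (induction p rule: induct_list012)
  case (2 x)
  thus ?case
    using spline_closed[OF assms(1), of x] by (simp add: minus_eq r_neg)
next
  case (3 x y p)
  have "\<rho> x \<ominus> \<rho> y \<in> \<alpha> {x, y}"
    using spline_adjacentD[OF assms(1)] "3.prems" by simp
  moreover have "\<rho> y \<ominus> \<rho> (last (y # p)) \<in> path_label R \<alpha> (y # p)"
    using "3.IH"(2) "3.prems" by simp
  ultimately have "(\<rho> x \<ominus> \<rho> y) \<oplus> (\<rho> y \<ominus> \<rho> (last (y # p))) \<in> path_label R \<alpha> (x # y # p)"
    unfolding path_label.simps set_add_def' by blast
  moreover have "x \<in> verts G" "y \<in> verts G" "last (y # p) \<in> verts G"
    using "3.prems"(2) last_in_set[of "y # p"] by auto
  ultimately show ?case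
    using minus_add_minus spline_closed[OF assms(1)] by simp
qed simp

lemma spline_diffs_subset_path_inter:
  assumes "u \<in> verts G" "w \<in> verts G"
  shows "spline_diffs R G \<alpha> u w \<subseteq> path_inter R G \<alpha> u w"
proof
  fix x assume "x \<in> spline_diffs R G \<alpha> u w"
  then obtain \<rho> where \<rho>: "spline R G \<alpha> \<rho>" "x = \<rho> u \<ominus> \<rho> w"
    by (rule spline_diffsE)
  thus "x \<in> path_inter R G \<alpha> u w"
    using assms spline_diff_in_path_label[OF \<rho>(1)] spline_closed[OF \<rho>(1)]
    by (auto simp: path_inter_def in_paths_iff)
qed

lemma UDP_iff_path_inter_eq:
  "UDP R G \<alpha> \<longleftrightarrow>
     (\<forall>u\<in>verts G. \<forall>w\<in>verts G. path_inter R G \<alpha> u w = spline_diffs R G \<alpha> u w)"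
  unfolding UDP_iff_path_inter_subset using spline_diffs_subset_path_inter by blast

lemma spline_const: "c \<in> carrier R \<Longrightarrow> spline R G \<alpha> (\<lambda>_. c)"
  using ideal_label
  by (auto simp: spline_def minus_eq r_neg intro: additive_subgroup.zero_closed ideal.axioms(1))

lemma spline_translate:
  assumes "spline R G \<alpha> \<rho>" "c \<in> carrier R"
  shows "spline R G \<alpha> (\<lambda>x. \<rho> x \<oplus> c)"
  unfolding spline_def
proof (intro conjI allI impI)
  show "(\<lambda>x. \<rho> x \<oplus> c) \<in> verts G \<rightarrow> carrier R"
    using assms by (auto simp: spline_closed)
  fix x y assume edge: "adjacent G x y"
  have "\<rho> x \<in> carrier R" "\<rho> y \<in> carrier R"
    using spline_closed[OF assms(1)] wf_graph_adjacentD[OF wf_graph edge] by auto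
  hence "(\<rho> x \<oplus> c) \<ominus> (\<rho> y \<oplus> c) = \<rho> x \<ominus> \<rho> y"
    using assms(2) by algebra
  thus "(\<rho> x \<oplus> c) \<ominus> (\<rho> y \<oplus> c) \<in> \<alpha> {x, y}"
    using spline_adjacentD[OF assms(1) edge] by simp
qed

lemma spline_uminus:
  assumes "spline R G \<alpha> \<rho>"
  shows "spline R G \<alpha> (\<lambda>x. \<ominus> \<rho> x)"
  unfolding spline_def
proof (intro conjI allI impI)
  show "(\<lambda>x. \<ominus> \<rho> x) \<in> verts G \<rightarrow> carrier R"
    using assms by (auto simp: spline_closed)
  fix x y assume edge: "adjacent G x y"
  have "\<rho> x \<in> carrier R" "\<rho> y \<in> carrier R"
    using spline_closed[OF assms] wf_graph_adjacentD[OF wf_graph edge] by auto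
  hence "\<ominus> \<rho> x \<ominus> \<ominus> \<rho> y = \<rho> y \<ominus> \<rho> x"
    by algebra
  thus "\<ominus> \<rho> x \<ominus> \<ominus> \<rho> y \<in> \<alpha> {x, y}"
    using spline_adjacentD[OF assms, of y x] edge by (simp add: insert_commute)
qed

lemma spline_diffs_commute:
  assumes "u \<in> verts G" "w \<in> verts G"
  shows "spline_diffs R G \<alpha> u w = spline_diffs R G \<alpha> w u"
proof -
  have "spline_diffs R G \<alpha> u w \<subseteq> spline_diffs R G \<alpha> w u" if "u \<in> verts G" "w \<in> verts G" for u w
  proof
    fix x assume "x \<in> spline_diffs R G \<alpha> u w"
    then obtain \<rho> where \<rho>: "spline R G \<alpha> \<rho>" "x = \<rho> u \<ominus> \<rho> w"
      by (rule spline_diffsE)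
    have "\<rho> u \<in> carrier R" "\<rho> w \<in> carrier R"
      using spline_closed[OF \<rho>(1)] that by auto
    hence "x = \<ominus> \<rho> w \<ominus> \<ominus> \<rho> u"
      unfolding \<rho>(2) by algebra
    thus "x \<in> spline_diffs R G \<alpha> w u"
      by (rule spline_diffsI[OF spline_uminus[OF \<rho>(1)]])
  qed
  thus ?thesis
    using assms by blast
qed

lemma spline_override_const:
  assumes "spline R G \<alpha> \<rho>" "c \<in> carrier R"
    and boundary: "\<And>x y. adjacent G x y \<Longrightarrow> x \<in> S \<Longrightarrow> y \<notin> S \<Longrightarrow> c \<ominus> \<rho> y \<in> \<alpha> {x, y}"
  shows "spline R G \<alpha> (override_on \<rho> (\<lambda>_. c) S)"
  unfolding spline_def
proof (intro conjI allI impI)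
  let ?\<tau> = "override_on \<rho> (\<lambda>_. c) S"
  show "?\<tau> \<in> verts G \<rightarrow> carrier R"
    using assms(1,2) by (auto simp: override_on_def spline_closed)
  fix x y assume edge: "adjacent G x y"
  have carr: "\<rho> x \<in> carrier R" "\<rho> y \<in> carrier R"
    using spline_closed[OF assms(1)] wf_graph_adjacentD[OF wf_graph edge] by auto
  interpret ideal "\<alpha> {x, y}" R
    using ideal_label[OF edge] .
  consider "x \<in> S" "y \<in> S" | "x \<in> S" "y \<notin> S" | "x \<notin> S" "y \<in> S" | "x \<notin> S" "y \<notin> S"
    by blast
  thus "?\<tau> x \<ominus> ?\<tau> y \<in> \<alpha> {x, y}"
  proof cases
    assume "x \<notin> S" "y \<in> S"
    hence "c \<ominus> \<rho> x \<in> \<alpha> {x, y}"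
      using boundary[of y x] edge by (simp add: insert_commute)
    moreover have "\<rho> x \<ominus> c = \<ominus> (c \<ominus> \<rho> x)"
      using carr assms(2) by algebra
    ultimately show ?thesis
      using \<open>x \<notin> S\<close> \<open>y \<in> S\<close> by (simp add: override_on_def)
  qed (use assms(2) boundary[OF edge] spline_adjacentD[OF assms(1) edge] in
      \<open>simp_all add: override_on_def minus_eq r_neg\<close>)
qed

lemma forest_spline_prescribe_first_edge:
  assumes "forest G" "u # v # p \<in> paths G u w" "spline R G \<alpha> \<rho>" "a \<in> \<alpha> {u, v}"
  obtains \<tau> where "spline R G \<alpha> \<tau>" "\<tau> u = \<rho> v \<oplus> a" "\<tau> w = \<rho> w"
proof
  let ?\<tau> = "override_on \<rho> (\<lambda>_. \<rho> v \<oplus> a) (branch G u v)"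
  have edge: "adjacent G u v" and "u \<noteq> v"
    using assms(2) by (auto simp: in_paths_iff)
  have carr: "\<rho> v \<in> carrier R" "a \<in> carrier R"
    using spline_closed[OF assms(3)] wf_graph_adjacentD[OF wf_graph edge] label_closed[OF edge] assms(4)
    by auto
  hence "(\<rho> v \<oplus> a) \<ominus> \<rho> v = a"
    by algebra
  hence "(\<rho> v \<oplus> a) \<ominus> \<rho> y \<in> \<alpha> {x, y}"
    if "adjacent G x y" "x \<in> branch G u v" "y \<notin> branch G u v" for x y
    using forest_branch_boundary[OF assms(1) edge that] assms(4) by simp
  thus "spline R G \<alpha> ?\<tau>"
    using carr by (intro spline_override_const[OF assms(3)]) auto
  have "[u] \<in> paths G u u"
    using assms(2) by (simp add: in_paths_iff)
  hence "u \<in> branch G u v"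
    using \<open>u \<noteq> v\<close> by (force simp: branch_def)
  thus "?\<tau> u = \<rho> v \<oplus> a" "?\<tau> w = \<rho> w"
    using forest_path_leaves_branch[OF assms(1,2)] by simp_all
qed

lemma forest_path_label_subset_spline_diffs:
  assumes "forest G" "p \<in> paths G u w"
  shows "path_label R \<alpha> p \<subseteq> spline_diffs R G \<alpha> u w"
  using assms(2)
proof (induction p arbitrary: u rule: induct_list012)
  case 1
  thus ?case by (simp add: in_paths_iff)
next
  case (2 y)
  thus ?case
    by (auto simp: minus_eq intro!: spline_diffsI[OF spline_const[OF zero_closed]])
next
  case (3 u' v p)
  have "u' = u"
    using "3.prems" by (simp add: in_paths_iff)
  note path = "3.prems"[unfolded this]
  have tail: "v # p \<in> paths G v w" and edge: "adjacent G u v"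
    using path by (auto simp: in_paths_iff)
  have "a \<oplus> b \<in> spline_diffs R G \<alpha> u w" if a: "a \<in> \<alpha> {u, v}" and b: "b \<in> path_label R \<alpha> (v # p)" for a b
  proof -
    obtain \<rho> where \<rho>: "spline R G \<alpha> \<rho>" "b = \<rho> v \<ominus> \<rho> w"
      using "3.IH"(2)[OF tail] b by (blast elim: spline_diffsE)
    obtain \<tau> where \<tau>: "spline R G \<alpha> \<tau>" "\<tau> u = \<rho> v \<oplus> a" "\<tau> w = \<rho> w"
      using forest_spline_prescribe_first_edge[OF assms(1) path \<rho>(1) a] .
    have "a \<in> carrier R" "\<rho> v \<in> carrier R" "\<rho> w \<in> carrier R"
      using a label_closed[OF edge] spline_closed[OF \<rho>(1)] path_endpoints[OF tail] by auto
    hence "a \<oplus> b = (\<rho> v \<oplus> a) \<ominus> \<rho> w"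
      unfolding \<rho>(2) by algebra
    thus ?thesis
      by (intro spline_diffsI[OF \<tau>(1)]) (simp add: \<tau>)
  qed
  thus ?case
    by (auto simp: \<open>u' = u\<close> set_add_def')
qed

lemma carrier_subset_spline_diffs_disconnected:
  assumes "u \<in> verts G" "paths G u w = {}"
  shows "carrier R \<subseteq> spline_diffs R G \<alpha> u w"
proof
  fix a assume a: "a \<in> carrier R"
  define S where "S = {y. paths G u y \<noteq> {}}"
  define \<tau> where "\<tau> = override_on (\<lambda>_. \<zero>) (\<lambda>_. a) S"
  have "y \<in> S" if "adjacent G x y" "x \<in> S" for x y
  proof -
    obtain p where "p \<in> paths G u x"
      using \<open>x \<in> S\<close> by (auto simp: S_def)
    thus ?thesis
      using path_extend_edge[OF _ that(1) wf_graph_adjacentD(2)[OF wf_graph that(1)]]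
      unfolding S_def by blast
  qed
  hence spline: "spline R G \<alpha> \<tau>"
    unfolding \<tau>_def using a by (intro spline_override_const spline_const) auto
  have "[u] \<in> paths G u u"
    using assms(1) by (simp add: in_paths_iff)
  hence "\<tau> u = a" "\<tau> w = \<zero>"
    using assms(2) by (auto simp: \<tau>_def S_def override_on_def)
  thus "a \<in> spline_diffs R G \<alpha> u w"
    using a by (intro spline_diffsI[OF spline]) (simp add: minus_eq)
qed

theorem UDP_forest:
  assumes "forest G"
  shows "UDP R G \<alpha>"
  unfolding UDP_iff_path_inter_subset
proof (intro ballI)
  fix u w assume u: "u \<in> verts G"
  show "path_inter R G \<alpha> u w \<subseteq> spline_diffs R G \<alpha> u w"
  proof (cases "paths G u w = {}")
    case True
    thus ?thesis
      using carrier_subset_spline_diffs_disconnected[OF u] by (auto simp: path_inter_def)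
  next
    case False
    then obtain p where p: "p \<in> paths G u w"
      by blast
    hence "path_inter R G \<alpha> u w \<subseteq> path_label R \<alpha> p"
      by (auto simp: path_inter_def)
    also note forest_path_label_subset_spline_diffs[OF assms p]
    finally show ?thesis .
  qed
qed

end

section \<open>Pasting\<close>

locale pasted_graphs =
  fixes H T :: "'v ugraph" and z :: 'v and G :: "'v ugraph"
  assumes pasting: "pasting H T z G" and wf_graph_left: "wf_graph H" and wf_graph_right: "wf_graph T"
begin

lemma verts_eq: "verts G = verts H \<union> verts T"
  and edges_eq: "edges G = edges H \<union> edges T"
  and verts_Int: "verts H \<inter> verts T = {z}"
  using pasting by (simp_all add: pasting_def)

lemma pasting_vertex: "z \<in> verts H" "z \<in> verts T"
  using verts_Int by auto

lemma pasted_graphs_commute: "pasted_graphs T H z G"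
  using pasting wf_graph_left wf_graph_right by unfold_locales (auto simp: pasting_def)

lemma wf_graph_pasting: "wf_graph G"
  using wf_graph_left wf_graph_right by (auto simp: wf_graph_def verts_eq edges_eq)

lemma subgraph_left: "subgraph H G"
  by (simp add: subgraph_def verts_eq edges_eq)

lemma walk_avoiding_pasting_vertex_stays_right:
  assumes "successively (adjacent G) p" "p \<noteq> []" "hd p \<in> verts T" "z \<notin> set p"
  shows "last p \<in> verts T"
  using assms
proof (induction p rule: induct_list012)
  case (3 x y p)
  have "x \<notin> verts H"
    using "3.prems" verts_Int by auto
  hence "adjacent T x y"
    using "3.prems"(1) edges_eq wf_graph_adjacentD(1)[OF wf_graph_left] by auto
  thus ?case
    using 3 wf_graph_adjacentD(2)[OF wf_graph_right] by auto
qed auto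

lemma path_stays_left:
  assumes "successively (adjacent G) p" "p \<noteq> []" "distinct p" "hd p \<in> verts H" "last p \<in> verts H"
  shows "set p \<subseteq> verts H \<and> successively (adjacent H) p"
  using assms
proof (induction p rule: induct_list012)
  case (3 x y p)
  have "adjacent H x y"
  proof (rule ccontr)
    assume "\<not> adjacent H x y"
    hence "adjacent T x y"
      using "3.prems"(1) by (simp add: edges_eq)
    hence "x \<in> verts T" "y \<in> verts T"
      using wf_graph_adjacentD[OF wf_graph_right] by auto
    hence "z \<notin> set (y # p)"
      using "3.prems"(3,4) verts_Int by auto
    hence "last (y # p) \<in> verts T"
      using "3.prems"(1) \<open>y \<in> verts T\<close> by (intro walk_avoiding_pasting_vertex_stays_right) auto
    hence "last (y # p) \<in> verts H \<inter> verts T"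
      using "3.prems"(5) by simp
    hence "last (y # p) = z"
      by (simp only: verts_Int singleton_iff)
    thus False
      using \<open>z \<notin> set (y # p)\<close> last_in_set by blast
  qed
  thus ?case
    using 3 wf_graph_adjacentD[OF wf_graph_left] by auto
qed auto

lemma paths_left:
  assumes "u \<in> verts H" "w \<in> verts H"
  shows "paths G u w = paths H u w"
proof (intro equalityI subsetI)
  fix p assume "p \<in> paths G u w"
  thus "p \<in> paths H u w"
    using path_stays_left[of p] assms by (auto simp: in_paths_iff)
next
  fix p assume "p \<in> paths H u w"
  thus "p \<in> paths G u w"
    by (auto simp: in_paths_iff verts_eq edges_eq elim!: successively_mono)
qed

lemma path_inter_left:
  "u \<in> verts H \<Longrightarrow> w \<in> verts H \<Longrightarrow> path_inter R G \<alpha> u w = path_inter R H \<alpha> u w"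
  by (simp add: path_inter_def paths_left)

lemma spline_diffs_left_subset: "spline_diffs R G \<alpha> u w \<subseteq> spline_diffs R H \<alpha> u w"
  by (blast intro: spline_diffsI spline_subgraph[OF _ subgraph_left] elim: spline_diffsE)

lemma UDP_left:
  assumes "UDP R G \<alpha>"
  shows "UDP R H \<alpha>"
  unfolding UDP_iff_path_inter_subset
proof (intro ballI)
  fix u w assume uw: "u \<in> verts H" "w \<in> verts H"
  hence "path_inter R H \<alpha> u w \<subseteq> spline_diffs R G \<alpha> u w"
    using assms by (auto simp: UDP_iff_path_inter_subset verts_eq simp flip: path_inter_left)
  also note spline_diffs_left_subset
  finally show "path_inter R H \<alpha> u w \<subseteq> spline_diffs R H \<alpha> u w" .
qed

end

locale pasted_labeled_graphs = ring R + pasted_graphs H T z G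
  for R (structure) and H T :: "'v ugraph" and z :: 'v and G :: "'v ugraph" +
  fixes \<alpha> :: "'v set \<Rightarrow> 'a set"
  assumes edge_labeling: "edge_labeling R G \<alpha>"
begin

sublocale H: labeled_graph R H \<alpha>
  using edge_labeling wf_graph_left by unfold_locales (auto simp: edge_labeling_def edges_eq)

sublocale T: labeled_graph R T \<alpha>
  using edge_labeling wf_graph_right by unfold_locales (auto simp: edge_labeling_def edges_eq)

sublocale G: labeled_graph R G \<alpha>
  using edge_labeling wf_graph_pasting by unfold_locales

lemma pasted_labeled_graphs_commute: "pasted_labeled_graphs R T H z G \<alpha>"
  using pasted_graphs_commute edge_labeling
  by (simp add: pasted_labeled_graphs_def pasted_labeled_graphs_axioms_def ring_axioms)

lemma spline_paste:
  assumes "spline R H \<alpha> \<rho>" "spline R T \<alpha> \<sigma>" "\<rho> z = \<sigma> z"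
  obtains \<tau> where "spline R G \<alpha> \<tau>"
    "\<And>x. x \<in> verts H \<Longrightarrow> \<tau> x = \<rho> x" "\<And>x. x \<in> verts T \<Longrightarrow> \<tau> x = \<sigma> x"
proof
  let ?\<tau> = "override_on \<sigma> \<rho> (verts H)"
  show left: "?\<tau> x = \<rho> x" if "x \<in> verts H" for x
    using that by simp
  show right: "?\<tau> x = \<sigma> x" if "x \<in> verts T" for x
    using that verts_Int assms(3) by (auto simp: override_on_def)
  have "?\<tau> x \<ominus> ?\<tau> y \<in> \<alpha> {x, y}" if edge: "adjacent G x y" for x y
  proof (cases "adjacent H x y")
    case True
    thus ?thesis
      using spline_adjacentD[OF assms(1)] wf_graph_adjacentD[OF wf_graph_left] by (simp add: left)
  next
    case False
    hence "adjacent T x y"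
      using edge by (simp add: edges_eq)
    thus ?thesis
      using spline_adjacentD[OF assms(2)] wf_graph_adjacentD[OF wf_graph_right] by (simp add: right)
  qed
  thus "spline R G \<alpha> ?\<tau>"
    using spline_closed[OF assms(1)] spline_closed[OF assms(2)]
    by (auto simp: spline_def verts_eq left right)
qed

lemma spline_diffs_left:
  assumes "u \<in> verts H" "w \<in> verts H"
  shows "spline_diffs R G \<alpha> u w = spline_diffs R H \<alpha> u w"
proof (intro equalityI spline_diffs_left_subset subsetI)
  fix x assume "x \<in> spline_diffs R H \<alpha> u w"
  then obtain \<rho> where \<rho>: "spline R H \<alpha> \<rho>" "x = \<rho> u \<ominus> \<rho> w"
    by (rule spline_diffsE)
  have "spline R T \<alpha> (\<lambda>_. \<rho> z)"
    using spline_closed[OF \<rho>(1)] pasting_vertex by (intro T.spline_const)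
  then obtain \<tau> where \<tau>: "spline R G \<alpha> \<tau>" "\<tau> u = \<rho> u" "\<tau> w = \<rho> w"
    using spline_paste[OF \<rho>(1)] assms by metis
  show "x \<in> spline_diffs R G \<alpha> u w"
    by (intro spline_diffsI[OF \<tau>(1)]) (simp add: \<tau> \<rho>(2))
qed

lemma spline_diffs_across:
  assumes u: "u \<in> verts H" and w: "w \<in> verts T"
  shows "spline_diffs R G \<alpha> u w = spline_diffs R H \<alpha> u z <+>\<^bsub>R\<^esub> spline_diffs R T \<alpha> z w"
proof (intro equalityI subsetI)
  fix x assume "x \<in> spline_diffs R G \<alpha> u w"
  then obtain \<rho> where \<rho>: "spline R G \<alpha> \<rho>" "x = \<rho> u \<ominus> \<rho> w"
    by (rule spline_diffsE)
  have "x = (\<rho> u \<ominus> \<rho> z) \<oplus> (\<rho> z \<ominus> \<rho> w)"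
    using spline_closed[OF \<rho>(1)] u w pasting_vertex by (simp add: \<rho>(2) minus_add_minus verts_eq)
  moreover have "spline R H \<alpha> \<rho>" "spline R T \<alpha> \<rho>"
    using spline_subgraph[OF \<rho>(1)] subgraph_left pasted_graphs.subgraph_left[OF pasted_graphs_commute] by auto
  ultimately show "x \<in> spline_diffs R H \<alpha> u z <+>\<^bsub>R\<^esub> spline_diffs R T \<alpha> z w"
    unfolding set_add_def' by (blast intro: spline_diffsI)
next
  fix x assume "x \<in> spline_diffs R H \<alpha> u z <+>\<^bsub>R\<^esub> spline_diffs R T \<alpha> z w"
  then obtain \<rho> \<sigma> where \<rho>: "spline R H \<alpha> \<rho>" and \<sigma>: "spline R T \<alpha> \<sigma>"
    and x: "x = (\<rho> u \<ominus> \<rho> z) \<oplus> (\<sigma> z \<ominus> \<sigma> w)"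
    by (auto simp: set_add_def' elim!: spline_diffsE)
  have carr: "\<rho> u \<in> carrier R" "\<rho> z \<in> carrier R" "\<sigma> z \<in> carrier R" "\<sigma> w \<in> carrier R"
    using spline_closed[OF \<rho>] spline_closed[OF \<sigma>] u w pasting_vertex by auto
  define d where "d = \<rho> z \<ominus> \<sigma> z"
  have "spline R T \<alpha> (\<lambda>y. \<sigma> y \<oplus> d)"
    using carr by (intro T.spline_translate[OF \<sigma>]) (simp add: d_def)
  moreover have "\<rho> z = \<sigma> z \<oplus> d"
    unfolding d_def using carr by algebra
  ultimately obtain \<tau> where \<tau>: "spline R G \<alpha> \<tau>" "\<tau> u = \<rho> u" "\<tau> w = \<sigma> w \<oplus> d"
    using spline_paste[OF \<rho>] u w by metis
  have "x = \<rho> u \<ominus> (\<sigma> w \<oplus> d)"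
    unfolding x d_def using carr by algebra
  thus "x \<in> spline_diffs R G \<alpha> u w"
    by (intro spline_diffsI[OF \<tau>(1)]) (simp add: \<tau>)
qed

lemma UDP_iff_parts_and_across:
  "UDP R G \<alpha> \<longleftrightarrow> UDP R H \<alpha> \<and> UDP R T \<alpha> \<and>
     (\<forall>u\<in>verts H. \<forall>w\<in>verts T. path_inter R G \<alpha> u w = spline_diffs R G \<alpha> u w)"
proof -
  let ?eq = "\<lambda>u w. path_inter R G \<alpha> u w = spline_diffs R G \<alpha> u w"
  have "?eq w u \<longleftrightarrow> ?eq u w" if "u \<in> verts H" "w \<in> verts T" for u w
    using that G.path_inter_commute[of u w] G.spline_diffs_commute[of u w] by (simp add: verts_eq)
  hence "UDP R G \<alpha> \<longleftrightarrow> (\<forall>u\<in>verts H. \<forall>w\<in>verts H. ?eq u w) \<and>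
      (\<forall>u\<in>verts T. \<forall>w\<in>verts T. ?eq u w) \<and> (\<forall>u\<in>verts H. \<forall>w\<in>verts T. ?eq u w)"
    unfolding G.UDP_iff_path_inter_eq verts_eq by blast
  moreover have "UDP R H \<alpha> \<longleftrightarrow> (\<forall>u\<in>verts H. \<forall>w\<in>verts H. ?eq u w)"
    by (simp add: H.UDP_iff_path_inter_eq path_inter_left spline_diffs_left)
  moreover have "UDP R T \<alpha> \<longleftrightarrow> (\<forall>u\<in>verts T. \<forall>w\<in>verts T. ?eq u w)"
    by (simp add: T.UDP_iff_path_inter_eq pasted_graphs.path_inter_left[OF pasted_graphs_commute]
        pasted_labeled_graphs.spline_diffs_left[OF pasted_labeled_graphs_commute])
  ultimately show ?thesis
    by simp
qed

theorem UDP_pasting_iff: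
  "UDP R G \<alpha> \<longleftrightarrow> UDP R H \<alpha> \<and> UDP R T \<alpha> \<and>
     (\<forall>u\<in>verts H. \<forall>w\<in>verts T.
        path_inter R G \<alpha> u w = path_inter R G \<alpha> u z <+>\<^bsub>R\<^esub> path_inter R G \<alpha> z w)"
proof -
  have "path_inter R G \<alpha> u z <+>\<^bsub>R\<^esub> path_inter R G \<alpha> z w = spline_diffs R G \<alpha> u w"
    if "UDP R H \<alpha>" "UDP R T \<alpha>" "u \<in> verts H" "w \<in> verts T" for u w
  proof -
    have "path_inter R G \<alpha> u z = spline_diffs R H \<alpha> u z"
      using that pasting_vertex by (simp add: path_inter_left H.UDP_iff_path_inter_eq)
    moreover have "path_inter R G \<alpha> z w = spline_diffs R T \<alpha> z w"
      using that pasting_vertex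
      by (simp add: pasted_graphs.path_inter_left[OF pasted_graphs_commute] T.UDP_iff_path_inter_eq)
    ultimately show ?thesis
      using that by (simp add: spline_diffs_across)
  qed
  thus ?thesis
    unfolding UDP_iff_parts_and_across by (intro conj_cong ball_cong refl) simp
qed

end

locale pasting_chain =
  fixes G T :: "nat \<Rightarrow> 'v ugraph" and v :: "nat \<Rightarrow> 'v" and m n :: nat
  assumes wf_graph_start: "wf_graph (G m)"
    and wf_graph_pasted: "\<And>i. i \<in> {m<..n} \<Longrightarrow> wf_graph (T i)"
    and pasting_step: "\<And>i. i \<in> {m<..n} \<Longrightarrow> pasting (G (i - 1)) (T i) (v i) (G i)"
begin

lemma wf_graph_chain:
  assumes "m \<le> k" "k \<le> n"
  shows "wf_graph (G k)"
  using assms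
proof (induction k rule: dec_induct)
  case base
  show ?case by (rule wf_graph_start)
next
  case (step i)
  hence "pasted_graphs (G i) (T (Suc i)) (v (Suc i)) (G (Suc i))"
    using wf_graph_pasted[of "Suc i"] pasting_step[of "Suc i"] by unfold_locales auto
  thus ?case
    by (rule pasted_graphs.wf_graph_pasting)
qed

lemma pasted_graphs_step:
  assumes "i \<in> {m<..n}"
  shows "pasted_graphs (G (i - 1)) (T i) (v i) (G i)"
  using assms wf_graph_chain[of "i - 1"] wf_graph_pasted[of i] pasting_step[of i]
  by unfold_locales auto

lemma UDP_chain_antimono:
  assumes "UDP R (G k) \<alpha>" "k \<le> n" "m \<le> j" "j \<le> k"
  shows "UDP R (G j) \<alpha>"
  using assms(4,3)
proof (induction j rule: inc_induct)
  case base
  show ?case by (rule assms(1))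
next
  case (step i)
  thus ?case
    using pasted_graphs.UDP_left[OF pasted_graphs_step[of "Suc i"]] assms(2) by simp
qed

end

theorem theorem2p9:
  fixes R :: "('a, 'm) ring_scheme"
    and C :: "'v ugraph" and n :: nat and v :: "nat \<Rightarrow> 'v"
    and T G :: "nat \<Rightarrow> 'v ugraph"
    and \<alpha> :: "'v set \<Rightarrow> 'a set"
  assumes "cring R"
    and "cycle_graph C" and "bij_betw v {1..n} (verts C)"
    and "\<And>i. i \<in> {1..n} \<Longrightarrow> tree (T i)"
    and "pasting C (T 1) (v 1) (G 1)"
    and "\<And>i. i \<in> {2..n} \<Longrightarrow> pasting (G (i - 1)) (T i) (v i) (G i)"
    and "edge_labeling R (G n) \<alpha>"
  shows "UDP R (G n) \<alpha> \<longleftrightarrow>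
    (\<forall>j\<in>{1..n - 1}. UDP R (G j) \<alpha>) \<and>
    (\<forall>u\<in>verts (G (n - 1)). \<forall>w\<in>verts (T n).
       path_inter R (G n) \<alpha> u w =
         path_inter R (G n) \<alpha> u (v n) <+>\<^bsub>R\<^esub> path_inter R (G n) \<alpha> (v n) w)"
proof -
  interpret cring R by fact
  have n: "n \<ge> 3"
    using card_verts_cycle_graph[OF assms(2)] bij_betw_same_card[OF assms(3)] by simp
  have wf_T: "wf_graph (T i)" if "i \<in> {1..n}" for i
    using assms(4)[OF that] by (simp add: tree_imp_forest forest_imp_wf_graph)
  have "pasted_graphs C (T 1) (v 1) (G 1)"
    using assms(5) cycle_graph_imp_wf_graph[OF assms(2)] wf_T n by unfold_locales auto
  then interpret chain: pasting_chain G T v 1 n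
    using wf_T assms(6) by unfold_locales (auto intro: pasted_graphs.wf_graph_pasting)
  interpret pasted_labeled_graphs R "G (n - 1)" "T n" "v n" "G n" \<alpha>
    using chain.pasted_graphs_step[of n] n assms(7)
    by (intro pasted_labeled_graphs.intro pasted_labeled_graphs_axioms.intro ring_axioms) auto
  have "UDP R (T n) \<alpha>"
    using assms(4) n by (intro T.UDP_forest tree_imp_forest) auto
  moreover have "UDP R (G (n - 1)) \<alpha> \<longleftrightarrow> (\<forall>j\<in>{1..n - 1}. UDP R (G j) \<alpha>)"
    using chain.UDP_chain_antimono[of R "n - 1" \<alpha>] n by auto
  ultimately show ?thesis
    using UDP_pasting_iff by blast
qed

end
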